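(* Let $\delta(a,r)$, $\zeta(a,r)$ and $\eta(a,r)$ be real functions defined on $(0,1/2]\times(0,1)$. Then: (1) If $0<p<1$, then the inequalities $$\frac{\varphi_K^a(r)^p}{\varphi_K^a(r^p)}>e^{\delta(a,r)\left(1-\frac1K\right)},\qquad e^{\zeta(a,r)(1-K)}<\frac{\varphi_{1/K}^a(r)^p}{\varphi_{1/K}^a(r^p)},\qquad \frac{\varphi_{1/K}^a(r)^p}{\varphi_{1/K}^a(r^p)}<e^{\eta(a,r)(1-K)}$$ hold for all $(a,r)\in(0,1/2]\times(0,1)$ and $K\in(1,\infty)$ if and only if, respectively, $\delta(a,r)\le p\,m_a(r)-m_a(r^p)$, $\zeta(a,r)\ge p\,m_a(r)-m_a(r^p)$, $\eta(a,r)\le p\,\mu_a(r)-\mu_a(r^p)$ for all $(a,r)\in(0,1/2]\times(0,1)$. (2) If $p>1$, then the inequalities $$\frac{\varphi_K^a(r)^p}{\varphi_K^a(r^p)}<e^{\delta(a,r)\left(1-\frac1K\right)},\qquad e^{\zeta(a,r)(1-K)}<\frac{\varphi_{1/K}^a(r)^p}{\varphi_{1/K}^a(r^p)},\qquad \frac{\varphi_{1/K}^a(r)^p}{\varphi_{1/K}^a(r^p)}<e^{\eta(a,r)(1-K)}$$ hold for all $(a,r)\in(0,1/2]\times(0,1)$ and $K\in(1,\infty)$ if and only if, respectively, $\delta(a,r)\ge p\,m_a(r)-m_a(r^p)$, $\zeta(a,r)\ge p\,\mu_a(r)-\mu_a(r^p)$, $\eta(a,r)\le p\,m_a(r)-m_a(r^p)$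 for all $(a,r)\in(0,1/2]\times(0,1)$. ("Respectively" means that in each part the three inequalities are separately equivalent to the three corresponding conditions.)
   Context: $F(\alpha,\beta;c;x)=\sum_{n=0}^\infty\frac{(\alpha)_n(\beta)_n}{(c)_n}\frac{x^n}{n!}$, $|x|<1$, is the Gaussian hypergeometric function, with $(x)_0=1$, $(x)_n=x(x+1)\cdots(x+n-1)$. For $a\in(0,1/2]$ and $r\in(0,1)$: the generalized Grötzsch ring function is $\mu_a(r)=\frac{\pi}{2\sin(\pi a)}\frac{F(a,1-a;1;1-r^2)}{F(a,1-a;1;r^2)}$, a strictly decreasing homeomorphism from $(0,1)$ onto $(0,\infty)$; the generalized Hübner function $m_a(r)$ is defined with the generalized elliptic integral $\mathscr{K}_a(r)=\frac{\pi}{2}F(a,1-a;1;r^2)$ by $m_a(r)=\frac{2}{\pi\sin(\pi a)}(1-r^2)\,\mathscr{K}_a(r)\,\mathscr{K}_a(\sqrt{1-r^2})$; for $K\in(0,\infty)$ the generalized Hersch–Pfluger distortion function is $\varphi_K^a(r)=\mu_a^{-1}(\mu_a(r)/K)$. The notation $\varphi_K^a(r)^p$ means $(\varphi_K^a(r))^p$. *)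

theory Defs
  imports "HOL-Analysis.Analysis"
begin

text \<open>
  The Gaussian hypergeometric series is meaningful only for \<open>\<bar>x\<bar> < 1\<close>; below it is
  evaluated only at \<open>r\<^sup>2\<close> and \<open>1 - r\<^sup>2\<close> with \<open>0 < r < 1\<close>, and \<open>c = 1\<close>.
\<close>

definition gauss_hypergeo :: "real \<Rightarrow> real \<Rightarrow> real \<Rightarrow> real \<Rightarrow> real" where
  "gauss_hypergeo \<alpha> \<beta> c x =
     (\<Sum>n. pochhammer \<alpha> n * pochhammer \<beta> n / pochhammer c n * (x ^ n / fact n))"

lemma gauss_hypergeo_eq_eval_fps:
  "gauss_hypergeo \<alpha> \<beta> c x = eval_fps (fps_hypergeo [\<alpha>, \<beta>] [c] 1) x"
  by (simp add: gauss_hypergeo_def eval_fps_def)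

definition gen_grotzsch :: "real \<Rightarrow> real \<Rightarrow> real" where
  "gen_grotzsch a r =
     pi / (2 * sin (pi * a)) *
       (gauss_hypergeo a (1 - a) 1 (1 - r\<^sup>2) / gauss_hypergeo a (1 - a) 1 (r\<^sup>2))"

definition gen_elliptic_K :: "real \<Rightarrow> real \<Rightarrow> real" where
  "gen_elliptic_K a r = pi / 2 * gauss_hypergeo a (1 - a) 1 (r\<^sup>2)"

definition gen_hubner :: "real \<Rightarrow> real \<Rightarrow> real" where
  "gen_hubner a r =
     2 / (pi * sin (pi * a)) * (1 - r\<^sup>2) * gen_elliptic_K a r * gen_elliptic_K a (sqrt (1 - r\<^sup>2))"

text \<open>
  For \<open>0 < a \<le> 1/2\<close> the function \<open>gen_grotzsch a\<close> is a bijection from \<open>(0,1)\<close> onto \<open>(0,\<infinity>)\<close>;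
  the inverse below is the inverse of its restriction to \<open>(0,1)\<close>.
\<close>

definition gen_hersch_pfluger :: "real \<Rightarrow> real \<Rightarrow> real \<Rightarrow> real" where
  "gen_hersch_pfluger a K r =
     the_inv_into {0<..<1} (gen_grotzsch a) (gen_grotzsch a r / K)"

end

theory Submission
  imports Defs "HOL-Real_Asymp.Real_Asymp"
begin

text \<open>
  Put \<open>N x = - ln (\<mu>\<^sup>-\<^sup>1 x)\<close> for the modulus \<open>\<mu>\<close> with parameter \<open>a\<close>, and let \<open>x = \<mu> r\<close>,
  \<open>y = \<mu> (r powr p)\<close>, so that \<open>p = N y / N x\<close>. The logarithm of the distortion ratio with parameter \<open>K\<close> is
  \<open>h u = N (u y) - p N (u x)\<close> at \<open>u = 1 / K\<close>; it vanishes at \<open>u = 1\<close>. As \<open>N' > 0\<close> is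
  \<open>- 1 / (r \<mu>' r)\<close> at \<open>x = \<mu> r\<close>, the Huebner function is \<open>x N' x\<close>, and the two kinds of bounds in the theorem
  are slopes of \<open>h\<close>: \<open>h' 1 = m (r powr p) - p m r\<close> for the Huebner function \<open>m\<close> and, because \<open>N'\<close> tends to \<open>1\<close>, the slope
  of \<open>h\<close> at infinity is \<open>y - p x\<close>. So the theorem says that for \<open>p < 1\<close>, that is \<open>y < x\<close>, the function
  \<open>h\<close> lies strictly above its tangent at \<open>1\<close> on both sides and, for \<open>u > 1\<close>, strictly below the line through
  \<open>(1, 0)\<close> with the slope at infinity. Both bounds are sharp by the definition of these slopes. The case
  \<open>p > 1\<close> follows by exchanging \<open>r\<close> and \<open>r powr p\<close>.

  The function \<open>h\<close> is not convex in general. The tangent bound holds because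
  \<open>(N (u x) - (u - 1) x N' x) / N x\<close> is decreasing in \<open>x\<close> for every fixed \<open>u \<noteq> 1\<close>
  (\<open>tangent_gap_strict_antimono\<close>), and the proof of this rests on two properties of \<open>N\<close>: it is
  convex, and the elasticity \<open>x N'' x / N' x\<close> decreases. The asymptote bound uses the convexity of \<open>N\<close> and
  \<open>N' < 1\<close> (\<open>asymptote_gap_strict_mono\<close>).

  For the hypergeometric modulus the elasticity is, with \<open>X = r\<^sup>2\<close>, \<open>q = a (1 - a)\<close>, \<open>F = F(a, 1 - a; 1; \<cdot>)\<close>
  and \<open>H = F(a, 1 - a; 2; \<cdot>)\<close>, a constant multiple of \<open>X F (1 - X) (F X - 2 q H X)\<close>
  (\<open>elasticity_eq\<close>). Both \<open>X F (1 - X)\<close> and \<open>F - 2 q H\<close> are positive and increase, while \<open>X\<close> decreases as a function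
  of \<open>x = \<mu> r\<close>. The derivative of \<open>\<mu>\<close> rests on the Legendre relation (\<open>legendre_relation\<close>), whose
  constant \<open>sin (\<pi> a) / \<pi>\<close> comes from the reflection formula of the Gamma function.
\<close>

section \<open>Convexity estimates for an abstract inverse modulus\<close>

text \<open>
  \<open>N\<close> stands for \<open>\<lambda>x. - ln (\<mu>\<^sup>-\<^sup>1 x)\<close>, where \<open>\<mu>\<close> is a decreasing modulus. The decisive hypothesis is the last one: the
  elasticity \<open>x g' x / g x\<close> of the derivative decreases.
\<close>

locale inverse_modulus =
  fixes N g g' :: "real \<Rightarrow> real"
  assumes N_deriv: "x > 0 \<Longrightarrow> (N has_real_derivative g x) (at x)"
    and g_deriv: "x > 0 \<Longrightarrow> (g has_real_derivative g' x) (at x)"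
    and N_pos: "x > 0 \<Longrightarrow> N x > 0"
    and g_pos: "x > 0 \<Longrightarrow> g x > 0"
    and g'_pos: "x > 0 \<Longrightarrow> g' x > 0"
    and N_zero: "(N \<longlongrightarrow> 0) (at_right 0)"
    and g_limit: "(g \<longlongrightarrow> 1) at_top"
    and elasticity_antimono: "0 < x \<Longrightarrow> x < y \<Longrightarrow> y * g' y / g y < x * g' x / g x"
begin

lemma g_strict_mono: "0 < x \<Longrightarrow> x < y \<Longrightarrow> g x < g y"
  by (rule DERIV_pos_imp_increasing[of x y g]) (use g_deriv g'_pos in \<open>meson order.strict_trans1 order.strict_trans2\<close>)+

lemma N_scaled_deriv:
  assumes "v * c > 0"
  shows "((\<lambda>v. N (v * c)) has_real_derivative g (v * c) * c) (at v)"
  by (rule DERIV_chain2[where f = N and g = "\<lambda>v. v * c"])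
     (use assms in \<open>auto intro!: derivative_eq_intros N_deriv\<close>)

lemma g_less_1:
  assumes "x > 0"
  shows "g x < 1"
proof -
  have "g x < g (x + 1)"
    using assms by (intro g_strict_mono) auto
  also have "g (x + 1) \<le> 1"
    using g_limit
  proof (rule tendsto_lowerbound)
    show "\<forall>\<^sub>F y in at_top. g (x + 1) \<le> g y"
      using eventually_gt_at_top[of "x + 1"]
      by eventually_elim (use assms in \<open>auto intro!: less_imp_le g_strict_mono\<close>)
  qed simp
  finally show ?thesis .
qed

text \<open>
  This is the monotone form of l'Hospital's rule at \<open>0\<close>: the quotient \<open>x g x / N x\<close> of two
  functions vanishing at \<open>0\<close> has \<open>1 + x g' x / g x\<close> as quotient of derivatives. The latter decreases,
  so the former exceeds it.
\<close>

lemma elasticity_less: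
  assumes y: "y > 0"
  shows "1 + y * g' y / g y < y * g y / N y"
proof -
  define D where "D = y * g' y / g y"
  define w where "w = (\<lambda>x. x * g x - (1 + D) * N x)"
  have w_mono: "w s < w t" if "0 < s" "s < t" "t \<le> y" for s t
  proof (rule DERIV_pos_imp_increasing_open[of s t w])
    fix x assume x: "s < x" "x < t"
    with that have x0: "x > 0" "x < y" by auto
    have "(w has_real_derivative g x + x * g' x - (1 + D) * g x) (at x)"
      unfolding w_def using x0
      by (auto intro!: derivative_eq_intros N_deriv g_deriv)
    moreover have "g x + x * g' x - (1 + D) * g x = g x * (x * g' x / g x - D)"
      using g_pos[OF x0(1)] by (simp add: field_simps)
    moreover have "g x * (x * g' x / g x - D) > 0"
      unfolding D_def using elasticity_antimono[OF x0] g_pos[OF x0(1)] by simp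
    ultimately show "\<exists>z. (w has_real_derivative z) (at x) \<and> 0 < z" by metis
  next
    show "continuous_on {s..t} w"
      unfolding w_def using that
      by (intro continuous_intros continuous_at_imp_continuous_on ballI
            DERIV_isCont[OF N_deriv] DERIV_isCont[OF g_deriv]) auto
  qed (use that in auto)
  have "((\<lambda>x. - ((1 + D) * N x)) \<longlongrightarrow> - ((1 + D) * 0)) (at_right 0)"
    by (intro tendsto_intros N_zero)
  hence "- ((1 + D) * 0) \<le> w (y/2)"
  proof (rule tendsto_upperbound)
    have "\<forall>\<^sub>F x in at_right (0::real). x \<in> {0<..<y/2}"
      using y by (intro eventually_at_right_real) auto
    thus "\<forall>\<^sub>F x in at_right 0. - ((1 + D) * N x) \<le> w (y/2)"
    proof eventually_elim
      case (elim x)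
      hence "w x < w (y/2)" using y by (intro w_mono) auto
      moreover have "x * g x > 0" using elim g_pos[of x] by simp
      ultimately show ?case unfolding w_def by linarith
    qed
  qed simp
  also have "w (y/2) < w y" using y by (intro w_mono) auto
  finally have "(1 + D) * N y < y * g y" unfolding w_def by simp
  thus ?thesis unfolding D_def[symmetric] using N_pos[OF y] by (simp add: field_simps)
qed

text \<open>
  This monotonicity compares the log ratio with its tangent at \<open>u = 1\<close>. Up to a positive factor, the
  derivative of the quotient is \<open>k (u z) - (u z - z) k' z\<close> with
  \<open>k s = s g s - E N s\<close> and \<open>E = z g z / N z\<close>. Since \<open>k z = 0\<close>, its sign is decided by comparing
  \<open>k' s = g s (1 + s g' s / g s - E)\<close> at a mean value \<open>s\<close> with \<open>k' z\<close>. The second factor decreases and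
  is negative at \<open>z\<close>, and \<open>g\<close> is positive and increasing: hence \<open>k'\<close> is larger than \<open>k' z\<close> to the left
  of \<open>z\<close> and smaller to the right.
\<close>

lemma tangent_gap_strict_antimono:
  assumes u: "u > 0" "u \<noteq> 1" and "0 < x" "x < y"
  shows "(N (u * y) - (u - 1) * (y * g y)) / N y < (N (u * x) - (u - 1) * (x * g x)) / N x"
proof (rule DERIV_neg_imp_decreasing[of x y "\<lambda>z. (N (u * z) - (u - 1) * (z * g z)) / N z"])
  fix z assume "x \<le> z" "z \<le> y"
  with assms have z: "z > 0" by auto
  define E where "E = z * g z / N z"
  define k where "k = (\<lambda>s. s * g s - E * N s)"
  define k' where "k' = (\<lambda>s. g s * (1 + s * g' s / g s - E))"
  have uz: "u * z > 0" using u z by simp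
  have k_deriv: "(k has_real_derivative k' s) (at s)" if "s > 0" for s
  proof -
    have "(k has_real_derivative g s + s * g' s - E * g s) (at s)"
      unfolding k_def using that by (auto intro!: derivative_eq_intros N_deriv g_deriv)
    also have "g s + s * g' s - E * g s = k' s"
      unfolding k'_def using g_pos[OF that] by (simp add: field_simps)
    finally show ?thesis .
  qed
  have k_z: "k z = 0"
    unfolding k_def E_def using N_pos[OF z] by simp
  have neg: "1 + z * g' z / g z - E < 0"
    unfolding E_def using elasticity_less[OF z] by simp
  have k'_below: "k' z < k' s" if "0 < s" "s < z" for s
  \<comment> \<open>The bracket may change sign left of the point \<open>z\<close>, so \<open>k'\<close> itself need not be monotone.\<close>
  proof (cases "1 + s * g' s / g s - E \<ge> 0")
    case True
    have "k' z < 0" unfolding k'_def using neg g_pos[OF z] by (simp add: mult_pos_neg)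
    also have "0 \<le> k' s" unfolding k'_def using True g_pos[of s] that by simp
    finally show ?thesis .
  next
    case False
    have "k' z < g s * (1 + z * g' z / g z - E)"
      unfolding k'_def using neg g_strict_mono[OF that] by simp
    also have "\<dots> < k' s"
      unfolding k'_def using elasticity_antimono[OF that] g_pos[of s] that by simp
    finally show ?thesis .
  qed
  have k'_above: "k' s < k' z" if "z < s" for s
  proof -
    have s: "s > 0" using z that by simp
    have "k' s < g s * (1 + z * g' z / g z - E)"
      unfolding k'_def using elasticity_antimono[OF z that] g_pos[OF s] by simp
    also have "\<dots> < k' z"
      unfolding k'_def using neg g_strict_mono[OF z that] by simp
    finally show ?thesis .
  qed
  have k_less: "k (u * z) < (u * z - z) * k' z"
  proof (cases "u > 1")
    case True
    hence lt: "z < u * z" using z by simp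
    obtain s where s: "z < s" "s < u * z" "k (u * z) - k z = (u * z - z) * k' s"
      using MVT2[OF lt, of k k'] k_deriv z by force
    have "(u * z - z) * k' s < (u * z - z) * k' z"
      using k'_above[OF s(1)] lt by (intro mult_strict_left_mono) auto
    with s(3) k_z show ?thesis by simp
  next
    case False
    hence lt: "u * z < z" using z u by simp
    obtain s where s: "u * z < s" "s < z" "k z - k (u * z) = (z - u * z) * k' s"
      using MVT2[OF lt, of k k'] k_deriv uz by force
    have "(z - u * z) * k' z < (z - u * z) * k' s"
      using k'_below[of s] s uz lt by (intro mult_strict_left_mono) auto
    with s(3) k_z show ?thesis by (simp add: algebra_simps)
  qed
  let ?A = "u * g (u * z) - (u - 1) * (g z + z * g' z)"
  let ?d = "(?A * N z - (N (u * z) - (u - 1) * (z * g z)) * g z) / (N z * N z)"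
  have Nu: "((\<lambda>z. N (u * z)) has_real_derivative u * g (u * z)) (at z)"
    using N_scaled_deriv[of z u] uz by (simp add: mult.commute)
  have "((\<lambda>z. (N (u * z) - (u - 1) * (z * g z)) / N z) has_real_derivative ?d) (at z)"
    using N_pos[OF z]
    by (rule_tac DERIV_cong[OF DERIV_divide[OF DERIV_diff[OF Nu
          DERIV_cmult[OF DERIV_mult[OF DERIV_ident g_deriv[OF z]]]] N_deriv[OF z]]])
       (simp_all add: algebra_simps)
  moreover have "?d = (k (u * z) - (u * z - z) * k' z) / (z * N z)"
    unfolding k_def k'_def E_def using z N_pos[OF z] g_pos[OF z]
    by (simp add: field_simps)
  moreover have "\<dots> < 0"
    using k_less z N_pos[OF z] by (intro divide_neg_pos) auto
  ultimately show "\<exists>d. ((\<lambda>z. (N (u * z) - (u - 1) * (z * g z)) / N z) has_real_derivative d) (at z) \<and> d < 0"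
    by metis
qed (use assms in auto)

lemma slope_strict_mono:
  assumes "0 < x" "x < y"
  shows "N x / x < N y / y"
proof (rule DERIV_pos_imp_increasing[of x y "\<lambda>z. N z / z"])
  fix z assume "x \<le> z" "z \<le> y"
  with assms have z: "z > 0" by auto
  have "((\<lambda>z. N z / z) has_real_derivative (g z * z - N z) / (z * z)) (at z)"
    using z by (auto intro!: derivative_eq_intros N_deriv simp: algebra_simps)
  moreover have "0 < (g z * z - N z) / (z * z)"
  proof -
    have "0 < z * g' z / g z" using z g_pos[OF z] g'_pos[OF z] by simp
    hence "1 < z * g z / N z" using elasticity_less[OF z] by linarith
    thus ?thesis using z N_pos[OF z] by (simp add: field_simps)
  qed
  ultimately show "\<exists>d. ((\<lambda>z. N z / z) has_real_derivative d) (at z) \<and> d > 0" by metis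
qed (use assms in auto)

text \<open>
  The difference of the two sides vanishes at \<open>u = 1\<close>, and its derivative in \<open>u\<close> has a sign because
  \<open>x / N x\<close> decreases (convexity of \<open>N\<close>) and so does \<open>1 - g\<close>, which is positive as \<open>g\<close> increases
  to \<open>1\<close>.
\<close>

lemma asymptote_gap_strict_mono:
  assumes u: "u > 1" and xy: "0 < x" "x < y"
  shows "(N (u * x) - (u - 1) * x) / N x < (N (u * y) - (u - 1) * y) / N y"
proof -
  define h where "h = (\<lambda>v. (N (v * x) - (v - 1) * x) / N x - (N (v * y) - (v - 1) * y) / N y)"
  have pos: "y > 0" "N x > 0" "N y > 0" using xy N_pos by auto
  have "h u < h 1"
  proof (rule DERIV_neg_imp_decreasing[of 1 u h])
    fix v assume v: "1 \<le> v" "v \<le> u"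
    have vx: "v * x > 0" "v * y > 0" "v * x < v * y" using v xy by auto
    have "(h has_real_derivative (g (v * x) * x - x) / N x - (g (v * y) * y - y) / N y) (at v)"
      unfolding h_def using vx pos
      by (auto intro!: derivative_eq_intros N_scaled_deriv)
    moreover have "(g (v * x) * x - x) / N x - (g (v * y) * y - y) / N y
        = y / N y * (1 - g (v * y)) - x / N x * (1 - g (v * x))"
      using pos by (simp add: field_simps)
    moreover have "y / N y * (1 - g (v * y)) < x / N x * (1 - g (v * x))"
    proof (rule mult_strict_mono)
      show "y / N y < x / N x"
        using slope_strict_mono[OF xy] pos xy by (simp add: field_simps)
      show "1 - g (v * y) < 1 - g (v * x)"
        using g_strict_mono[of "v * x" "v * y"] vx by simp
    qed (use pos xy g_less_1[of "v * y"] vx in auto)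
    ultimately show "\<exists>d. (h has_real_derivative d) (at v) \<and> d < 0" by force
  qed (use u in auto)
  moreover have "h 1 = 0" unfolding h_def using pos by simp
  ultimately show ?thesis unfolding h_def by simp
qed

lemma slope_limit: "((\<lambda>x. N x / x) \<longlongrightarrow> 1) at_top"
proof (rule lhospital_at_top_at_top[where g' = "\<lambda>_. 1" and f' = g])
  show "\<forall>\<^sub>F x in at_top. (N has_real_derivative g x) (at x)"
    using eventually_gt_at_top[of 0] by eventually_elim (rule N_deriv)
qed (use g_limit in \<open>auto intro: filterlim_ident\<close>)

text \<open>
  With \<open>x = \<mu> r\<close>, \<open>y = \<mu> (r powr p)\<close> one has \<open>N y / N x = p\<close>, and \<open>log_ratio x y (1 / K)\<close> is the
  logarithm of the distortion ratio with parameter \<open>K\<close>; see \<open>distortion_ratio\<close> below.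
\<close>

definition log_ratio :: "real \<Rightarrow> real \<Rightarrow> real \<Rightarrow> real" where
  "log_ratio x y u = N (u * y) - N y / N x * N (u * x)"

lemma log_ratio_1: "x > 0 \<Longrightarrow> log_ratio x y 1 = 0"
  using N_pos[of x] by (simp add: log_ratio_def)

lemma log_ratio_above_tangent:
  assumes "u > 0" "u \<noteq> 1" "0 < y" "y < x"
  shows "(u - 1) * (y * g y - N y / N x * (x * g x)) < log_ratio x y u"
proof -
  have pos: "N x > 0" "N y > 0" using assms N_pos by auto
  have "N y * ((N (u * x) - (u - 1) * (x * g x)) / N x)
      < N y * ((N (u * y) - (u - 1) * (y * g y)) / N y)"
    using tangent_gap_strict_antimono[of u y x] assms pos by (intro mult_strict_left_mono)
  moreover have "N y * ((N (u * x) - (u - 1) * (x * g x)) / N x)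
      = N y / N x * N (u * x) - (u - 1) * (N y / N x * (x * g x))"
    using pos by (simp add: field_simps)
  moreover have "N y * ((N (u * y) - (u - 1) * (y * g y)) / N y) = N (u * y) - (u - 1) * (y * g y)"
    using pos by simp
  ultimately show ?thesis unfolding log_ratio_def by (simp add: algebra_simps)
qed

lemma log_ratio_below_asymptote:
  assumes "u > 1" "0 < y" "y < x"
  shows "log_ratio x y u < (u - 1) * (y - N y / N x * x)"
proof -
  have pos: "N x > 0" "N y > 0" using assms N_pos by auto
  have "N y * ((N (u * y) - (u - 1) * y) / N y) < N y * ((N (u * x) - (u - 1) * x) / N x)"
    using asymptote_gap_strict_mono[of u y x] assms pos by (intro mult_strict_left_mono)
  moreover have "N y * ((N (u * x) - (u - 1) * x) / N x)
      = N y / N x * N (u * x) - (u - 1) * (N y / N x * x)"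
    using pos by (simp add: field_simps)
  moreover have "N y * ((N (u * y) - (u - 1) * y) / N y) = N (u * y) - (u - 1) * y"
    using pos by simp
  ultimately show ?thesis unfolding log_ratio_def by (simp add: algebra_simps)
qed

lemma log_ratio_deriv_1:
  assumes "x > 0" "y > 0"
  shows "(log_ratio x y has_real_derivative y * g y - N y / N x * (x * g x)) (at 1)"
  unfolding log_ratio_def[abs_def] using assms N_pos[of x]
  by (auto intro!: derivative_eq_intros N_scaled_deriv)

lemma log_ratio_asymptotic_slope:
  assumes "x > 0" "y > 0"
  shows "((\<lambda>u. log_ratio x y u / (u - 1)) \<longlongrightarrow> y - N y / N x * x) at_top"
proof -
  have scaled: "((\<lambda>u. N (u * c) / (u * c)) \<longlongrightarrow> 1) at_top" if "c > 0" for c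
    using that
    by (intro filterlim_compose[OF slope_limit] filterlim_at_top_mult_tendsto_pos[OF tendsto_const])
       (auto intro: filterlim_ident simp: mult.commute)
  have 1: "((\<lambda>u::real. 1 / (1 - 1 / u)) \<longlongrightarrow> 1 / (1 - 0)) at_top"
    by (intro tendsto_intros tendsto_divide_0[OF tendsto_const] filterlim_at_top_imp_at_infinity filterlim_ident) auto
  have "((\<lambda>u. (y * (N (u * y) / (u * y)) - N y / N x * (x * (N (u * x) / (u * x)))) * (1 / (1 - 1 / u)))
      \<longlongrightarrow> (y * 1 - N y / N x * (x * 1)) * (1 / (1 - 0))) at_top"
    by (intro tendsto_mult[OF _ 1] tendsto_diff tendsto_mult tendsto_const scaled assms)
  hence "((\<lambda>u. (y * (N (u * y) / (u * y)) - N y / N x * (x * (N (u * x) / (u * x)))) * (1 / (1 - 1 / u)))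
      \<longlongrightarrow> y - N y / N x * x) at_top" by simp
  moreover have "\<forall>\<^sub>F u in at_top. (y * (N (u * y) / (u * y)) - N y / N x * (x * (N (u * x) / (u * x)))) * (1 / (1 - 1 / u))
      = log_ratio x y u / (u - 1)"
    using eventually_gt_at_top[of 1]
  proof eventually_elim
    case (elim u)
    thus ?case unfolding log_ratio_def using assms N_pos[of x] by (simp add: divide_simps)
  qed
  ultimately show ?thesis by (rule Lim_transform_eventually)
qed

end

section \<open>Sharp constants in linear bounds\<close>

text \<open>
  Necessity comes from letting \<open>K\<close> decrease to \<open>1\<close>: the difference quotient of \<open>h\<close> at \<open>1\<close> tends to \<open>d\<close>
  from both sides, the left side being parametrised by \<open>u = 1 / K\<close> and the right side by \<open>u = K\<close>.
\<close>

lemma sharp_tangent_iff: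
  fixes h :: "real \<Rightarrow> real"
  assumes h1: "h 1 = 0" and deriv: "(h has_real_derivative d) (at 1)"
    and above: "\<And>u. u > 0 \<Longrightarrow> u \<noteq> 1 \<Longrightarrow> (u - 1) * d < h u"
  shows sharp_tangent_left_iff: "(\<forall>K>1. c * (1 - 1 / K) < h (1 / K)) \<longleftrightarrow> c \<le> - d"
    and sharp_tangent_right_iff: "(\<forall>K>1. c * (1 - K) < h K) \<longleftrightarrow> c \<ge> - d"
proof -
  have q: "((\<lambda>u. h u / (u - 1)) \<longlongrightarrow> d) (at 1)"
    using deriv h1 by (simp add: has_field_derivative_iff)
  show "(\<forall>K>1. c * (1 - 1 / K) < h (1 / K)) \<longleftrightarrow> c \<le> - d"
  proof
    assume *: "\<forall>K>1. c * (1 - 1 / K) < h (1 / K)"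
    have "((\<lambda>u. h u / (u - 1)) \<longlongrightarrow> d) (at_left 1)"
      using q by (rule tendsto_mono[OF at_le, rotated]) auto
    hence "d \<le> - c"
    proof (rule tendsto_upperbound)
      have "\<forall>\<^sub>F u in at_left (1::real). u \<in> {0<..<1}"
        by (intro eventually_at_left_real) auto
      thus "\<forall>\<^sub>F u in at_left 1. h u / (u - 1) \<le> - c"
      proof eventually_elim
        case (elim u)
        thus ?case using *[rule_format, of "1 / u"] by (auto simp: field_simps)
      qed
    qed simp
    thus "c \<le> - d" by simp
  next
    assume c: "c \<le> - d"
    show "\<forall>K>1. c * (1 - 1 / K) < h (1 / K)"
    proof (intro allI impI)
      fix K :: real assume K: "K > 1"
      have "c * (1 - 1 / K) \<le> - d * (1 - 1 / K)"
        using c K by (intro mult_right_mono) auto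
      also have "\<dots> = (1 / K - 1) * d" by (simp add: algebra_simps)
      also have "\<dots> < h (1 / K)" using K by (intro above) auto
      finally show "c * (1 - 1 / K) < h (1 / K)" .
    qed
  qed
  show "(\<forall>K>1. c * (1 - K) < h K) \<longleftrightarrow> c \<ge> - d"
  proof
    assume *: "\<forall>K>1. c * (1 - K) < h K"
    have "((\<lambda>u. h u / (u - 1)) \<longlongrightarrow> d) (at_right 1)"
      using q by (rule tendsto_mono[OF at_le, rotated]) auto
    hence "- c \<le> d"
    proof (rule tendsto_lowerbound)
      have "\<forall>\<^sub>F u in at_right (1::real). u \<in> {1<..<2}"
        by (intro eventually_at_right_real) auto
      thus "\<forall>\<^sub>F u in at_right 1. - c \<le> h u / (u - 1)"
      proof eventually_elim
        case (elim u)
        thus ?case using *[rule_format, of u] by (auto simp: field_simps)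
      qed
    qed simp
    thus "c \<ge> - d" by simp
  next
    assume c: "c \<ge> - d"
    show "\<forall>K>1. c * (1 - K) < h K"
    proof (intro allI impI)
      fix K :: real assume K: "K > 1"
      have "c * (1 - K) \<le> - d * (1 - K)"
        using c K by (intro mult_right_mono_neg) auto
      also have "\<dots> = (K - 1) * d" by (simp add: algebra_simps)
      also have "\<dots> < h K" using K by (intro above) auto
      finally show "c * (1 - K) < h K" .
    qed
  qed
qed

text \<open>
  Here the extremal slope is the one at infinity, so necessity comes from letting \<open>K\<close> tend to infinity.
\<close>

lemma sharp_asymptote_iff:
  fixes h :: "real \<Rightarrow> real"
  assumes lim: "((\<lambda>u. h u / (u - 1)) \<longlongrightarrow> e) at_top"
    and below: "\<And>u. u > 1 \<Longrightarrow> h u < (u - 1) * e"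
  shows "(\<forall>K>1. h K < c * (1 - K)) \<longleftrightarrow> c \<le> - e"
proof
  assume *: "\<forall>K>1. h K < c * (1 - K)"
  from lim have "e \<le> - c"
  proof (rule tendsto_upperbound)
    show "\<forall>\<^sub>F u in at_top. h u / (u - 1) \<le> - c"
      using eventually_gt_at_top[of 1]
    proof eventually_elim
      case (elim u)
      thus ?case using *[rule_format, of u] by (auto simp: field_simps)
    qed
  qed simp
  thus "c \<le> - e" by simp
next
  assume c: "c \<le> - e"
  show "\<forall>K>1. h K < c * (1 - K)"
  proof (intro allI impI)
    fix K :: real assume K: "K > 1"
    have "h K < (K - 1) * e" using K by (rule below)
    also have "\<dots> = - e * (1 - K)" by (simp add: algebra_simps)
    also have "\<dots> \<le> c * (1 - K)" using c K by (intro mult_right_mono_neg) auto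
    finally show "h K < c * (1 - K)" .
  qed
qed

section \<open>The zero-balanced hypergeometric function and its companion\<close>

locale hypergeometric_parameter =
  fixes a :: real
  assumes a_pos: "0 < a" and a_le_half: "a \<le> 1 / 2"
begin

abbreviation F :: "real \<Rightarrow> real" where
  "F \<equiv> gauss_hypergeo a (1 - a) 1"

definition q :: real where
  "q = a * (1 - a)"

text \<open>
  This is \<open>1 / (\<Gamma>(a) \<Gamma>(1 - a))\<close>. It governs the coefficients of \<open>F\<close>, which behave like \<open>\<kappa> / n\<close>, and is the
  constant in the Legendre relation.
\<close>

definition \<kappa> :: real where
  "\<kappa> = sin (pi * a) / pi"

definition c :: "nat \<Rightarrow> real" where
  "c n = pochhammer a n * pochhammer (1 - a) n / (fact n)\<^sup>2"

definition h :: "nat \<Rightarrow> real" where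
  "h n = c n / (real n + 1)"

text \<open>
  \<open>H\<close> is the hypergeometric function \<open>F(a, 1 - a; 2; \<cdot>)\<close>. It is used because it turns the
  second-order hypergeometric equation into the first-order system \<open>(1 - x) F' = q H\<close>, \<open>(x H)' = F\<close>.
\<close>

definition H :: "real \<Rightarrow> real" where
  "H x = (\<Sum>n. h n * x ^ n)"

lemma F_eq: "F x = (\<Sum>n. c n * x ^ n)"
  unfolding gauss_hypergeo_def c_def
  by (simp add: pochhammer_fact[symmetric] power2_eq_square)

lemma q_pos: "q > 0"
  unfolding q_def using a_pos a_le_half by simp

lemma q_le: "q \<le> 1 / 4"
proof -
  have "0 \<le> (a - 1 / 2)\<^sup>2" by simp
  thus ?thesis unfolding q_def by (simp add: power2_eq_square algebra_simps)
qed

lemma \<kappa>_pos: "\<kappa> > 0"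
proof -
  have "pi * a < pi" using a_le_half by simp
  hence "sin (pi * a) > 0" using a_pos by (intro sin_gt_zero) auto
  thus ?thesis unfolding \<kappa>_def by simp
qed

lemma c_0 [simp]: "c 0 = 1"
  by (simp add: c_def)

lemma c_Suc: "c (Suc n) * (real n + 1)\<^sup>2 = c n * ((real n)\<^sup>2 + real n + q)"
proof -
  have "fact (Suc n) = (real n + 1) * fact n" by simp
  hence "c (Suc n) * (real n + 1)\<^sup>2
      = pochhammer a (Suc n) * pochhammer (1 - a) (Suc n) / (fact n)\<^sup>2"
    unfolding c_def by (simp add: power_mult_distrib add.commute)
  thus ?thesis
    unfolding c_def q_def pochhammer_Suc by (simp add: power2_eq_square algebra_simps)
qed

lemma c_pos: "c n > 0"
  unfolding c_def using a_pos a_le_half by (auto intro!: divide_pos_pos mult_pos_pos pochhammer_pos)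

lemma c_le_1: "c n \<le> 1"
proof (induction n)
  case (Suc n)
  have "(real n)\<^sup>2 + real n + q \<le> (real n + 1)\<^sup>2"
    using q_le by (simp add: power2_eq_square algebra_simps)
  hence "c n * ((real n)\<^sup>2 + real n + q) \<le> 1 * (real n + 1)\<^sup>2"
    using Suc c_pos[of n] q_pos by (intro mult_mono) auto
  hence "c (Suc n) * (real n + 1)\<^sup>2 \<le> 1 * (real n + 1)\<^sup>2"
    by (simp only: c_Suc)
  thus ?case by (rule mult_right_le_imp_le) auto
qed simp

lemma h_mult: "h n * (real n + 1) = c n"
  unfolding h_def by simp

lemma h_pos: "0 < h n"
  unfolding h_def using c_pos[of n] by simp

lemma h_le: "h n \<le> c n"
  unfolding h_def using c_pos[of n] by (simp add: field_simps)

lemma coeff_step: "q * h n = (real n + 1) * c (Suc n) - real n * c n"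
proof -
  have "(real n + 1) * ((real n + 1) * c (Suc n)) = (real n + 1) * (q * h n + real n * c n)"
    using c_Suc[of n] h_mult[of n] unfolding power2_eq_square by algebra
  hence "(real n + 1) * c (Suc n) = q * h n + real n * c n"
    by (subst (asm) mult_cancel_left) auto
  thus ?thesis by simp
qed

lemma summable_bounded_coeff:
  fixes b :: "nat \<Rightarrow> real"
  assumes "\<And>n. \<bar>b n\<bar> \<le> 1" "\<bar>x\<bar> < 1"
  shows "summable (\<lambda>n. b n * x ^ n)"
proof (rule summable_comparison_test')
  show "summable (\<lambda>n. \<bar>x\<bar> ^ n)" using assms(2) by (simp add: summable_geometric)
  show "norm (b n * x ^ n) \<le> \<bar>x\<bar> ^ n" if "n \<ge> 0" for n
    using mult_right_mono[OF assms(1)[of n], of "\<bar>x\<bar> ^ n"] by (simp add: abs_mult power_abs)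
qed

lemma summable_F: "\<bar>x\<bar> < 1 \<Longrightarrow> summable (\<lambda>n. c n * x ^ n)"
  using c_le_1 c_pos by (intro summable_bounded_coeff) (simp add: abs_of_pos)

lemma summable_H: "\<bar>x\<bar> < 1 \<Longrightarrow> summable (\<lambda>n. h n * x ^ n)"
proof (intro summable_bounded_coeff)
  show "\<bar>h n\<bar> \<le> 1" for n
    using h_pos[of n] h_le[of n] c_le_1[of n] by linarith
qed

lemma diffs_sums:
  fixes b :: "nat \<Rightarrow> real"
  assumes "\<And>x. \<bar>x\<bar> < 1 \<Longrightarrow> summable (\<lambda>n. b n * x ^ n)" "\<bar>x\<bar> < 1"
  shows "(\<lambda>n. diffs b n * x ^ n) sums (\<Sum>n. diffs b n * x ^ n)"
    and "(\<lambda>n. real n * b n * x ^ n) sums (x * (\<Sum>n. diffs b n * x ^ n))"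
proof -
  show *: "(\<lambda>n. diffs b n * x ^ n) sums (\<Sum>n. diffs b n * x ^ n)"
    by (intro summable_sums termdiff_converges[of x 1]) (use assms in auto)
  have "(\<lambda>n. real (Suc n) * b (Suc n) * x ^ Suc n) sums (x * (\<Sum>n. diffs b n * x ^ n))"
    using sums_mult[OF *, of x] by (simp add: diffs_def algebra_simps)
  from sums_Suc[where f = "\<lambda>n. real n * b n * x ^ n", OF this]
  show "(\<lambda>n. real n * b n * x ^ n) sums (x * (\<Sum>n. diffs b n * x ^ n))" by simp
qed

lemma F_deriv:
  assumes "\<bar>x\<bar> < 1"
  shows "(F has_real_derivative q * H x / (1 - x)) (at x)"
proof -
  define D where "D = (\<Sum>n. diffs c n * x ^ n)"
  have "(\<lambda>n. diffs c n * x ^ n - real n * c n * x ^ n) sums (D - x * D)"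
    unfolding D_def by (intro sums_diff diffs_sums summable_F assms)
  moreover have "diffs c n * x ^ n - real n * c n * x ^ n = q * (h n * x ^ n)" for n
    using arg_cong[OF coeff_step[of n], of "\<lambda>t. t * x ^ n"] by (simp add: diffs_def algebra_simps)
  moreover have "(\<lambda>n. q * (h n * x ^ n)) sums (q * H x)"
    unfolding H_def by (intro sums_mult summable_sums summable_H assms)
  ultimately have "D - x * D = q * H x"
    using sums_unique2 by simp
  hence "D = q * H x / (1 - x)" using assms by (simp add: field_simps)
  moreover have "((\<lambda>x. \<Sum>n. c n * x ^ n) has_real_derivative D) (at x)"
    unfolding D_def by (rule termdiffs_strong'[of 1]) (use summable_F assms in auto)
  ultimately show ?thesis unfolding F_eq[abs_def] by simp
qed

lemma xH_deriv:
  assumes "\<bar>x\<bar> < 1"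
  shows "((\<lambda>x. x * H x) has_real_derivative F x) (at x)"
proof -
  define D where "D = (\<Sum>n. diffs h n * x ^ n)"
  have "(\<lambda>n. h n * x ^ n + real n * h n * x ^ n) sums (H x + x * D)"
    unfolding D_def H_def
    by (intro sums_add diffs_sums(2) summable_sums summable_H assms)
  moreover have "h n * x ^ n + real n * h n * x ^ n = c n * x ^ n" for n
    unfolding h_mult[symmetric] by (simp add: algebra_simps)
  moreover have "(\<lambda>n. c n * x ^ n) sums F x"
    unfolding F_eq by (intro summable_sums summable_F assms)
  ultimately have "H x + x * D = F x"
    using sums_unique2 by simp
  moreover have "(H has_real_derivative D) (at x)"
    unfolding D_def H_def[abs_def] by (rule termdiffs_strong'[of 1]) (use summable_H assms in auto)
  ultimately show ?thesis
    by (auto intro!: derivative_eq_intros simp: algebra_simps)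
qed

lemma H_isCont: "\<bar>x\<bar> < 1 \<Longrightarrow> isCont H x"
  unfolding H_def[abs_def]
  by (rule DERIV_isCont[OF termdiffs_strong'[of 1]]) (use summable_H in auto)

lemma F_isCont: "\<bar>x\<bar> < 1 \<Longrightarrow> isCont F x"
  by (rule DERIV_isCont[OF F_deriv])

lemma F_0: "F 0 = 1"
  unfolding F_eq by (subst powser_zero) simp

lemma H_ge_1:
  assumes "0 \<le> x" "x < 1"
  shows "H x \<ge> 1"
proof -
  have "(\<Sum>n\<in>{0}. h n * x ^ n) \<le> H x"
    unfolding H_def using assms h_pos
    by (intro sum_le_suminf summable_H ballI mult_nonneg_nonneg less_imp_le[OF h_pos]) auto
  thus ?thesis by (simp add: h_def)
qed

lemma H_le_F:
  assumes "0 \<le> x" "x < 1"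
  shows "H x \<le> F x"
  unfolding H_def F_eq using assms h_le
  by (intro suminf_le summable_H summable_F mult_right_mono) auto

lemma F_ge_1: "0 \<le> x \<Longrightarrow> x < 1 \<Longrightarrow> F x \<ge> 1"
  using H_ge_1 H_le_F by force

text \<open>
  Two factors of Gauss's product for \<open>1 / \<Gamma>\<close>, at \<open>a\<close> and \<open>1 - a\<close>, multiply to this sequence, because the
  powers \<open>n\<^sup>a\<close> and \<open>n\<^sup>1\<^sup>-\<^sup>a\<close> combine to \<open>n\<close>. Euler's reflection formula evaluates the limit.
\<close>

lemma n_c_limit: "(\<lambda>n. real n * c n) \<longlonglongrightarrow> \<kappa>"
proof -
  have "complex_of_real (rGamma a * rGamma (1 - a)) = complex_of_real \<kappa>"
    using rGamma_reflection_complex[of "complex_of_real a"] rGamma_complex_of_real[of "1 - a"]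
    unfolding \<kappa>_def
    by (simp add: rGamma_complex_of_real sin_of_real[symmetric] flip: of_real_mult)
  hence eq: "rGamma a * rGamma (1 - a) = \<kappa>"
    by (simp only: of_real_eq_iff)
  have "(\<lambda>n. rGamma_series a n * rGamma_series (1 - a) n * (real n / real (Suc n))) \<longlonglongrightarrow> \<kappa> * 1"
    unfolding eq[symmetric] by (intro tendsto_mult rGamma_series_LIMSEQ LIMSEQ_n_over_Suc_n)
  moreover have "\<forall>\<^sub>F n in sequentially. rGamma_series a n * rGamma_series (1 - a) n * (real n / real (Suc n))
      = real (Suc n) * c (Suc n)"
    using eventually_gt_at_top[of 0]
  proof eventually_elim
    case (elim n)
    have "exp (a * ln (real n)) * exp ((1 - a) * ln (real n)) = real n"
      unfolding exp_add[symmetric] using elim by (simp add: algebra_simps)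
    hence "rGamma_series a n * rGamma_series (1 - a) n
        = pochhammer a (Suc n) * pochhammer (1 - a) (Suc n) / ((fact n)\<^sup>2 * real n)"
      unfolding rGamma_series_def by (simp add: power2_eq_square field_simps)
    moreover have "c (Suc n) = pochhammer a (Suc n) * pochhammer (1 - a) (Suc n) / ((fact n)\<^sup>2 * (real (Suc n))\<^sup>2)"
      unfolding c_def by (simp add: power_mult_distrib mult.commute)
    ultimately show ?case using elim by (simp add: power2_eq_square del: of_nat_Suc pochhammer_Suc)
  qed
  ultimately have "(\<lambda>n. real (Suc n) * c (Suc n)) \<longlonglongrightarrow> \<kappa>"
    by (simp add: tendsto_cong)
  thus ?thesis by (rule LIMSEQ_imp_Suc)
qed

text \<open>
  By \<open>coeff_step\<close> the partial sums telescope to \<open>n c\<^sub>n / q\<close>.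
\<close>

lemma H_coeff_sums: "(\<lambda>n. h n) sums (\<kappa> / q)"
proof -
  have "(\<Sum>k<n. h k) = real n * c n / q" for n
  proof -
    have "(\<Sum>k<n. q * h k) = (\<Sum>k<n. real (Suc k) * c (Suc k) - real k * c k)"
      by (simp only: coeff_step) (simp add: add.commute)
    also have "\<dots> = real n * c n" by (subst sum_lessThan_telescope) simp
    finally show ?thesis unfolding sum_distrib_left[symmetric] using q_pos by (simp add: field_simps)
  qed
  moreover have "(\<lambda>n. real n * c n / q) \<longlonglongrightarrow> \<kappa> / q"
    by (intro tendsto_divide n_c_limit tendsto_const) (use q_pos in auto)
  ultimately show ?thesis unfolding sums_def by simp
qed

lemma H_1: "H 1 = \<kappa> / q"
  unfolding H_def using H_coeff_sums by (simp add: sums_iff)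

text \<open>
  Continuity up to the boundary point \<open>1\<close> is what the evaluation of the constant in the Legendre relation
  needs.
\<close>

lemma H_continuous: "continuous_on {0..1} H"
proof -
  have "uniform_limit {0..1} (\<lambda>n x. \<Sum>i<n. h i * x ^ i) H sequentially"
    unfolding H_def[abs_def]
  proof (rule Weierstrass_m_test)
    fix n and x :: real assume x: "x \<in> {0..1}"
    have "\<bar>x ^ n\<bar> \<le> 1" using x by (simp add: power_le_one)
    hence "h n * \<bar>x ^ n\<bar> \<le> h n * 1"
      using h_pos[of n] by (intro mult_left_mono) auto
    thus "norm (h n * x ^ n) \<le> h n"
      using h_pos[of n] by (simp add: abs_mult)
  qed (use H_coeff_sums in \<open>simp add: sums_iff\<close>)
  thus ?thesis
    by (rule uniform_limit_theorem[rotated]) (auto intro!: always_eventually continuous_intros)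
qed

lemma H_le:
  assumes "0 \<le> x" "x < 1"
  shows "q * H x \<le> \<kappa>"
proof -
  have "H x \<le> H 1" unfolding H_def
  proof (rule suminf_le)
    show "summable (\<lambda>n. h n * x ^ n)" using assms by (intro summable_H) auto
    show "h n * x ^ n \<le> h n * 1 ^ n" for n
      using assms h_pos[of n] by (intro mult_left_mono) (auto intro!: power_le_one)
    show "summable (\<lambda>n. h n * 1 ^ n)" using H_coeff_sums by (simp add: sums_iff)
  qed
  thus ?thesis unfolding H_1 using q_pos by (simp add: field_simps)
qed

text \<open>
  Both bounds integrate \<open>F' = q H / (1 - x)\<close> with \<open>1 \<le> H \<le> \<kappa> / q\<close>. The lower one shows that \<open>F\<close> is unbounded
  at \<open>1\<close>, the upper one that \<open>(1 - x) F x\<close> tends to \<open>0\<close> there.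
\<close>

lemma F_log_bounds:
  assumes "0 \<le> x" "x < 1"
  shows "1 - q * ln (1 - x) \<le> F x" "F x \<le> 1 - \<kappa> * ln (1 - x)"
proof -
  have "F 0 + q * ln (1 - 0) \<le> F x + q * ln (1 - x)"
  proof (rule DERIV_nonneg_imp_nondecreasing[where f = "\<lambda>t. F t + q * ln (1 - t)", OF assms(1)])
    fix t assume t: "0 \<le> t" "t \<le> x"
    have "((\<lambda>t. F t + q * ln (1 - t)) has_real_derivative q * (H t - 1) / (1 - t)) (at t)"
      using t assms by (auto intro!: derivative_eq_intros F_deriv simp: diff_divide_distrib right_diff_distrib)
    moreover have "q * (H t - 1) / (1 - t) \<ge> 0"
      using H_ge_1[of t] q_pos t assms by simp
    ultimately show "\<exists>d. ((\<lambda>t. F t + q * ln (1 - t)) has_real_derivative d) (at t) \<and> 0 \<le> d" by blast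
  qed
  thus "1 - q * ln (1 - x) \<le> F x" by (simp add: F_0)
  have "- \<kappa> * ln (1 - 0) - F 0 \<le> - \<kappa> * ln (1 - x) - F x"
  proof (rule DERIV_nonneg_imp_nondecreasing[where f = "\<lambda>t. - \<kappa> * ln (1 - t) - F t", OF assms(1)])
    fix t assume t: "0 \<le> t" "t \<le> x"
    have "((\<lambda>t. - \<kappa> * ln (1 - t) - F t) has_real_derivative (\<kappa> - q * H t) / (1 - t)) (at t)"
      using t assms by (auto intro!: derivative_eq_intros F_deriv simp: diff_divide_distrib right_diff_distrib)
    moreover have "(\<kappa> - q * H t) / (1 - t) \<ge> 0"
      using H_le[of t] t assms by simp
    ultimately show "\<exists>d. ((\<lambda>t. - \<kappa> * ln (1 - t) - F t) has_real_derivative d) (at t) \<and> 0 \<le> d" by blast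
  qed
  thus "F x \<le> 1 - \<kappa> * ln (1 - x)" by (simp add: F_0)
qed

text \<open>
  This is the generalized Legendre relation, or equivalently the value of the Wronskian of \<open>F x\<close> and
  \<open>F (1 - x)\<close>. The system for \<open>F\<close> and \<open>H\<close> makes the derivative of the left side vanish, so it is
  constant on \<open>(0, 1)\<close>; at \<open>0\<close> only the second summand survives, with limit \<open>q H 1 = \<kappa>\<close>.
\<close>

lemma legendre_relation:
  assumes x: "0 < x" "x < 1"
  shows "q * (x * H x * F (1 - x) + (1 - x) * H (1 - x) * F x) = \<kappa>"
proof -
  define V where "V = (\<lambda>x. x * H x * F (1 - x) + (1 - x) * H (1 - x) * F x)"
  have const: "V y = V x" if y: "0 < y" "y < 1" for y
  proof (rule DERIV_isconst3[of 0 1 y x V])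
    fix t :: real assume "t \<in> {0<..<1}"
    hence t: "0 < t" "t < 1" by auto
    have Fr: "((\<lambda>x. F (1 - x)) has_real_derivative q * H (1 - t) / t * (-1)) (at t)"
      by (rule DERIV_chain2[where f = F and g = "\<lambda>x. 1 - x"], rule DERIV_cong[OF F_deriv])
         (use t in \<open>auto intro!: derivative_eq_intros\<close>)
    have Jr: "((\<lambda>x. (1 - x) * H (1 - x)) has_real_derivative F (1 - t) * (-1)) (at t)"
      using t by (intro DERIV_chain2[where f = "\<lambda>x. x * H x" and g = "\<lambda>x. 1 - x" and x = t, OF xH_deriv])
        (auto intro!: derivative_eq_intros)
    show "(V has_real_derivative 0) (at t)"
      unfolding V_def
      by (rule DERIV_cong[OF DERIV_add[OF DERIV_mult[OF xH_deriv Fr] DERIV_mult[OF Jr F_deriv]]])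
         (use t in \<open>auto simp: field_simps\<close>)
  qed (use x y in auto)
  have xF: "((\<lambda>y. y * F (1 - y)) \<longlongrightarrow> 0) (at_right 0)"
  proof (rule tendsto_sandwich)
    have *: "\<forall>\<^sub>F y in at_right (0::real). y \<in> {0<..<1}" by (intro eventually_at_right_real) auto
    show "\<forall>\<^sub>F y in at_right 0. y * F (1 - y) \<le> y * (1 - \<kappa> * ln y)"
      using * by eventually_elim (use F_log_bounds(2)[of "1 - _"] in auto)
    show "\<forall>\<^sub>F y in at_right 0. 0 \<le> y * F (1 - y)"
      using *
    proof eventually_elim
      case (elim y)
      hence "1 \<le> F (1 - y)" by (intro F_ge_1) auto
      with elim show ?case by simp
    qed
    show "((\<lambda>y. y * (1 - \<kappa> * ln y)) \<longlongrightarrow> 0) (at_right 0)" by real_asymp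
  qed simp
  have "(H \<longlongrightarrow> H 0) (at_right 0)" "(F \<longlongrightarrow> F 0) (at_right 0)"
    using H_isCont[of 0] F_isCont[of 0] by (auto simp: isCont_def intro: tendsto_mono[OF at_le])
  moreover have "((\<lambda>y. H (1 - y)) \<longlongrightarrow> H (1 - 0)) (at_right 0)"
  proof -
    have "continuous_on {0..1} (\<lambda>y. H (1 - y))"
      by (intro continuous_on_compose2[OF H_continuous] continuous_intros) auto
    thus ?thesis
      using continuous_on_Icc_at_rightD[of 0 1 "\<lambda>y. H (1 - y)"] by simp
  qed
  ultimately have "((\<lambda>y. H y * (y * F (1 - y)) + (1 - y) * H (1 - y) * F y)
      \<longlongrightarrow> H 0 * 0 + (1 - 0) * H (1 - 0) * F 0) (at_right 0)"
    by (intro tendsto_intros xF)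
  moreover have "(\<lambda>y. H y * (y * F (1 - y)) + (1 - y) * H (1 - y) * F y) = V"
    by (simp add: V_def fun_eq_iff)
  ultimately have "(V \<longlongrightarrow> \<kappa> / q) (at_right 0)" by (simp add: H_1 F_0)
  moreover have "(V \<longlongrightarrow> V x) (at_right 0)"
  proof (rule tendsto_eventually)
    have "\<forall>\<^sub>F y in at_right (0::real). y \<in> {0<..<1}" by (intro eventually_at_right_real) auto
    thus "\<forall>\<^sub>F y in at_right 0. V y = V x" by eventually_elim (use const in auto)
  qed
  ultimately have "V x = \<kappa> / q" using tendsto_unique[OF trivial_limit_at_right_real] by blast
  thus ?thesis unfolding V_def using q_pos by simp
qed

section \<open>The modulus and its inverse\<close>

abbreviation \<mu> :: "real \<Rightarrow> real" where
  "\<mu> \<equiv> gen_grotzsch a"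

lemma square_in_unit: "0 < r \<Longrightarrow> r < 1 \<Longrightarrow> 0 < r\<^sup>2" "0 < r \<Longrightarrow> r < 1 \<Longrightarrow> r\<^sup>2 < 1" for r :: real
  by (auto simp: power_less_one_iff)

lemma F_pos: "0 \<le> x \<Longrightarrow> x < 1 \<Longrightarrow> F x > 0"
  using F_ge_1[of x] by simp

lemma \<mu>_eq: "\<mu> r = F (1 - r\<^sup>2) / F (r\<^sup>2) / (2 * \<kappa>)"
  unfolding gen_grotzsch_def \<kappa>_def by (simp add: mult_ac)

lemma \<mu>_pos: "0 < r \<Longrightarrow> r < 1 \<Longrightarrow> \<mu> r > 0"
  unfolding \<mu>_eq using \<kappa>_pos F_pos[of "r\<^sup>2"] F_pos[of "1 - r\<^sup>2"] square_in_unit[of r] by simp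

text \<open>
  The quotient rule produces the Wronskian of \<open>F X\<close> and \<open>F (1 - X)\<close>, which the Legendre relation evaluates.
\<close>

lemma \<mu>_deriv:
  assumes r: "0 < r" "r < 1"
  shows "(\<mu> has_real_derivative - 1 / (r * (1 - r\<^sup>2) * (F (r\<^sup>2))\<^sup>2)) (at r)"
proof -
  define X where "X = r\<^sup>2"
  have X: "0 < X" "X < 1" using square_in_unit r by (auto simp: X_def)
  have F_X: "F X > 0" using F_pos[of X] X by simp
  have d1: "((\<lambda>r. F (r\<^sup>2)) has_real_derivative q * H X / (1 - X) * (2 * r)) (at r)"
    by (rule DERIV_chain2[where f = F and g = "\<lambda>r. r\<^sup>2"], rule DERIV_cong[OF F_deriv])
       (use X in \<open>auto intro!: derivative_eq_intros simp: X_def\<close>)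
  have d2: "((\<lambda>r. F (1 - r\<^sup>2)) has_real_derivative q * H (1 - X) / X * (- 2 * r)) (at r)"
    by (rule DERIV_chain2[where f = F and g = "\<lambda>r. 1 - r\<^sup>2"], rule DERIV_cong[OF F_deriv])
       (use X in \<open>auto intro!: derivative_eq_intros simp: X_def\<close>)
  have L: "q * (X * H X * F (1 - X) + (1 - X) * H (1 - X) * F X) = \<kappa>"
    by (rule legendre_relation) (use X in auto)
  have eq: "(q * H (1 - X) / X * (- 2 * r) * F X - F (1 - X) * (q * H X / (1 - X) * (2 * r)))
      = - 2 * r * \<kappa> / (X * (1 - X))"
    unfolding L[symmetric] using X by (simp add: field_simps)
  have "(\<mu> has_real_derivative
      (q * H (1 - X) / X * (- 2 * r) * F X - F (1 - X) * (q * H X / (1 - X) * (2 * r))) / (F X * F X) / (2 * \<kappa>)) (at r)"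
    unfolding \<mu>_eq[abs_def] X_def
    by (intro DERIV_cdivide DERIV_divide d1[unfolded X_def] d2[unfolded X_def])
       (use F_X in \<open>simp add: X_def\<close>)
  also have "(q * H (1 - X) / X * (- 2 * r) * F X - F (1 - X) * (q * H X / (1 - X) * (2 * r))) / (F X * F X) / (2 * \<kappa>)
      = - 1 / (r * (1 - X) * (F X)\<^sup>2)"
    unfolding eq using X F_X \<kappa>_pos r by (simp add: X_def power2_eq_square)
  finally show ?thesis by (simp add: X_def)
qed

lemma \<mu>_strict_antimono:
  assumes "0 < r" "r < s" "s < 1"
  shows "\<mu> s < \<mu> r"
proof (rule DERIV_neg_imp_decreasing[OF assms(2)])
  fix t assume t: "r \<le> t" "t \<le> s"
  hence t': "0 < t" "t < 1" using assms by auto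
  have "- 1 / (t * (1 - t\<^sup>2) * (F (t\<^sup>2))\<^sup>2) < 0"
    using t' square_in_unit[OF t'] F_pos[of "t\<^sup>2"] by simp
  with \<mu>_deriv[OF t'] show "\<exists>d. (\<mu> has_real_derivative d) (at t) \<and> d < 0" by blast
qed

lemma \<mu>_less_iff:
  "0 < r \<Longrightarrow> r < 1 \<Longrightarrow> 0 < s \<Longrightarrow> s < 1 \<Longrightarrow> \<mu> s < \<mu> r \<longleftrightarrow> r < s"
  using \<mu>_strict_antimono by (metis less_asym linorder_neqE_linordered_idom less_irrefl)

lemma \<mu>_isCont: "0 < r \<Longrightarrow> r < 1 \<Longrightarrow> isCont \<mu> r"
  by (rule DERIV_isCont[OF \<mu>_deriv])

lemma F_at_top: "filterlim F at_top (at_left 1)"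
proof (rule filterlim_at_top_mono)
  show "filterlim (\<lambda>x. 1 - q * ln (1 - x)) at_top (at_left 1)"
    using q_pos by real_asymp
  have "\<forall>\<^sub>F x in at_left (1::real). x \<in> {0<..<1}" by (intro eventually_at_left_real) auto
  thus "\<forall>\<^sub>F x in at_left 1. 1 - q * ln (1 - x) \<le> F x"
    by eventually_elim (use F_log_bounds in auto)
qed

lemma F_ratio_limits:
  "((\<lambda>x. F (1 - x) / F x) \<longlongrightarrow> 0) (at_left 1)"
  "filterlim (\<lambda>x. F (1 - x) / F x) at_top (at_right 0)"
proof -
  have F0: "(F \<longlongrightarrow> 1) (at 0)" using F_isCont[of 0] by (simp add: isCont_def F_0)
  have r: "filterlim (\<lambda>x::real. 1 - x) (at_left 1) (at_right 0)" by real_asymp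
  have l: "filterlim (\<lambda>x::real. 1 - x) (at_right 0) (at_left 1)" by real_asymp
  have F0r: "(F \<longlongrightarrow> 1) (at_right 0)" using F0 by (rule tendsto_mono[OF at_le, rotated]) auto
  show "((\<lambda>x. F (1 - x) / F x) \<longlongrightarrow> 0) (at_left 1)"
    by (rule tendsto_divide_0[OF filterlim_compose[OF F0r l]
          filterlim_at_top_imp_at_infinity[OF F_at_top]])
  have "filterlim (\<lambda>x. inverse (F x) * F (1 - x)) at_top (at_right 0)"
    using tendsto_inverse[OF F0r]
    by (intro filterlim_tendsto_pos_mult_at_top[OF _ _ filterlim_compose[OF F_at_top r]]) auto
  thus "filterlim (\<lambda>x. F (1 - x) / F x) at_top (at_right 0)"
    by (simp add: field_simps)
qed

lemma \<mu>_surj: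
  assumes "x > 0"
  obtains r where "0 < r" "r < 1" "\<mu> r = x"
proof -
  have "\<forall>\<^sub>F X in at_left 1. F (1 - X) / F X < 2 * \<kappa> * x"
    using F_ratio_limits(1) by (rule order_tendstoD) (use assms \<kappa>_pos in auto)
  moreover have "\<forall>\<^sub>F X in at_left (1::real). X \<in> {0<..<1}" by (intro eventually_at_left_real) auto
  ultimately have "\<forall>\<^sub>F X in at_left 1. X \<in> {0<..<1} \<and> F (1 - X) / F X < 2 * \<kappa> * x"
    by eventually_elim auto
  then obtain X where X: "0 < X" "X < 1" "F (1 - X) / F X < 2 * \<kappa> * x"
    using eventually_happens'[OF trivial_limit_at_left_real] by force
  have "\<forall>\<^sub>F Y in at_right 0. F (1 - Y) / F Y > 2 * \<kappa> * x"
    using F_ratio_limits(2) by (simp add: filterlim_at_top_dense)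
  moreover have "\<forall>\<^sub>F Y in at_right (0::real). Y \<in> {0<..<1}" by (intro eventually_at_right_real) auto
  ultimately have "\<forall>\<^sub>F Y in at_right 0. Y \<in> {0<..<1} \<and> F (1 - Y) / F Y > 2 * \<kappa> * x"
    by eventually_elim auto
  then obtain Y where Y: "0 < Y" "Y < 1" "F (1 - Y) / F Y > 2 * \<kappa> * x"
    using eventually_happens'[OF trivial_limit_at_right_real] by force
  have lt: "\<mu> (sqrt X) < x" "x < \<mu> (sqrt Y)"
    unfolding \<mu>_eq using X Y \<kappa>_pos
    by (simp_all add: pos_divide_less_eq pos_less_divide_eq mult_ac del: divide_divide_eq_left)
  hence "\<mu> (sqrt X) < \<mu> (sqrt Y)" by simp
  hence "sqrt Y < sqrt X"
    using X Y by (subst (asm) \<mu>_less_iff) auto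
  have unit: "0 < sqrt Y" "sqrt X < 1" using X Y by auto
  have "\<exists>r. sqrt Y \<le> r \<and> r \<le> sqrt X \<and> \<mu> r = x"
  proof (rule IVT2)
    show "\<forall>t. sqrt Y \<le> t \<and> t \<le> sqrt X \<longrightarrow> isCont \<mu> t"
    proof (intro allI impI)
      fix t assume "sqrt Y \<le> t \<and> t \<le> sqrt X"
      with unit have "0 < t" "t < 1" by linarith+
      thus "isCont \<mu> t" by (rule \<mu>_isCont)
    qed
  qed (use lt \<open>sqrt Y < sqrt X\<close> in linarith)+
  then obtain r where r: "sqrt Y \<le> r" "r \<le> sqrt X" "\<mu> r = x" by blast
  with unit have "0 < r" "r < 1" by linarith+
  thus ?thesis using that r(3) by blast
qed

definition \<mu>_inv :: "real \<Rightarrow> real" where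
  "\<mu>_inv = the_inv_into {0<..<1} \<mu>"

lemma \<mu>_bij: "bij_betw \<mu> {0<..<1} {0<..}"
proof (rule bij_betw_imageI)
  show "inj_on \<mu> {0<..<1}"
  proof (rule inj_onI)
    fix r s assume "r \<in> {0<..<1}" "s \<in> {0<..<1}" and eq: "\<mu> r = \<mu> s"
    thus "r = s" using \<mu>_strict_antimono[of r s] \<mu>_strict_antimono[of s r]
      by (cases r s rule: linorder_cases) auto
  qed
  show "\<mu> ` {0<..<1} = {0<..}"
  proof (intro equalityI subsetI)
    fix x :: real assume "x \<in> {0<..}"
    then obtain r where "0 < r" "r < 1" "\<mu> r = x" using \<mu>_surj[of x] by auto
    thus "x \<in> \<mu> ` {0<..<1}" by (intro image_eqI[of _ _ r]) auto
  qed (use \<mu>_pos in auto)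
qed

lemma \<mu>_inv_in_unit:
  assumes "x > 0"
  shows "0 < \<mu>_inv x" "\<mu>_inv x < 1"
  using the_inv_into_into[of \<mu> "{0<..<1}" x "{0<..<1}"] \<mu>_bij assms
  by (auto simp: \<mu>_inv_def bij_betw_def)

lemma \<mu>_\<mu>_inv: "x > 0 \<Longrightarrow> \<mu> (\<mu>_inv x) = x"
  using f_the_inv_into_f_bij_betw[OF \<mu>_bij, of x] by (simp add: \<mu>_inv_def)

lemma \<mu>_inv_\<mu>: "0 < r \<Longrightarrow> r < 1 \<Longrightarrow> \<mu>_inv (\<mu> r) = r"
  using the_inv_into_f_f[of \<mu> "{0<..<1}" r] \<mu>_bij by (simp add: \<mu>_inv_def bij_betw_def)

lemma \<mu>_inv_less_iff: "x > 0 \<Longrightarrow> 0 < r \<Longrightarrow> r < 1 \<Longrightarrow> \<mu>_inv x < r \<longleftrightarrow> \<mu> r < x"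
  and less_\<mu>_inv_iff: "x > 0 \<Longrightarrow> 0 < r \<Longrightarrow> r < 1 \<Longrightarrow> r < \<mu>_inv x \<longleftrightarrow> x < \<mu> r"
  using \<mu>_less_iff[of "\<mu>_inv x" r] \<mu>_less_iff[of r "\<mu>_inv x"] \<mu>_inv_in_unit[of x] \<mu>_\<mu>_inv[of x] by auto

lemma \<mu>_inv_strict_antimono: "0 < x \<Longrightarrow> x < y \<Longrightarrow> \<mu>_inv y < \<mu>_inv x"
  using \<mu>_inv_less_iff[of y "\<mu>_inv x"] \<mu>_inv_in_unit[of x] \<mu>_\<mu>_inv[of x] by auto

lemma \<mu>_inv_deriv:
  assumes x: "x > 0"
  shows "(\<mu>_inv has_real_derivative - (\<mu>_inv x * (1 - (\<mu>_inv x)\<^sup>2) * (F ((\<mu>_inv x)\<^sup>2))\<^sup>2)) (at x)"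
proof -
  note r = \<mu>_inv_in_unit[OF x]
  have cont: "isCont \<mu>_inv (\<mu> (\<mu>_inv x))"
  proof (rule isCont_inverse_function2[of "\<mu>_inv x / 2" "\<mu>_inv x" "(\<mu>_inv x + 1) / 2" \<mu>_inv \<mu>])
    fix z assume "\<mu>_inv x / 2 \<le> z" "z \<le> (\<mu>_inv x + 1) / 2"
    hence "0 < z" "z < 1" using r by auto
    thus "\<mu>_inv (\<mu> z) = z" "isCont \<mu> z" using \<mu>_inv_\<mu> \<mu>_isCont by auto
  qed (use r in auto)
  have "(\<mu>_inv has_real_derivative inverse (- 1 / (\<mu>_inv x * (1 - (\<mu>_inv x)\<^sup>2) * (F ((\<mu>_inv x)\<^sup>2))\<^sup>2))) (at x)"
  proof (rule DERIV_inverse_function[where f = \<mu> and a = 0 and b = "x + 1"])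
    show "(\<mu> has_real_derivative - 1 / (\<mu>_inv x * (1 - (\<mu>_inv x)\<^sup>2) * (F ((\<mu>_inv x)\<^sup>2))\<^sup>2)) (at (\<mu>_inv x))"
      by (rule \<mu>_deriv[OF r])
    show "- 1 / (\<mu>_inv x * (1 - (\<mu>_inv x)\<^sup>2) * (F ((\<mu>_inv x)\<^sup>2))\<^sup>2) \<noteq> 0"
      using r square_in_unit[OF r] F_pos[of "(\<mu>_inv x)\<^sup>2"] by simp
  qed (use x \<mu>_\<mu>_inv cont in auto)
  thus ?thesis by simp
qed

text \<open>
  At \<open>X = r\<^sup>2\<close> this is the reciprocal of \<open>- r \<mu>' r\<close>, that is, the derivative of \<open>- ln r\<close> with respect to
  \<open>\<mu> r\<close>.
\<close>

definition \<gamma> :: "real \<Rightarrow> real" where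
  "\<gamma> X = (1 - X) * (F X)\<^sup>2"

definition \<gamma>' :: "real \<Rightarrow> real" where
  "\<gamma>' X = - (F X * (F X - 2 * (q * H X)))"

lemma \<gamma>_deriv:
  assumes "\<bar>X\<bar> < 1"
  shows "(\<gamma> has_real_derivative \<gamma>' X) (at X)"
proof -
  have "((\<lambda>X. (1 - X) * (F X * F X)) has_real_derivative
      (- 1) * (F X * F X) + (q * H X / (1 - X) * F X + q * H X / (1 - X) * F X) * (1 - X)) (at X)"
    by (intro DERIV_mult F_deriv assms) (auto intro!: derivative_eq_intros)
  also have "(- 1) * (F X * F X) + (q * H X / (1 - X) * F X + q * H X / (1 - X) * F X) * (1 - X) = \<gamma>' X"
  proof -
    define W where "W = q * H X / (1 - X)"
    have "W * (1 - X) = q * H X" using assms by (simp add: W_def)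
    thus ?thesis unfolding \<gamma>'_def W_def[symmetric] by algebra
  qed
  finally show ?thesis unfolding \<gamma>_def[abs_def] power2_eq_square .
qed

lemma \<gamma>_pos: "0 \<le> X \<Longrightarrow> X < 1 \<Longrightarrow> \<gamma> X > 0"
  unfolding \<gamma>_def using F_pos[of X] by simp

lemma F_minus_qH_pos:
  assumes "0 \<le> x" "x < 1"
  shows "F x - 2 * (q * H x) > 0" "F x - q * H x > 0"
proof -
  have "q * H x \<le> 1 / 4 * F x"
    using q_le q_pos H_le_F[OF assms] H_ge_1[OF assms] by (intro mult_mono) auto
  thus "F x - 2 * (q * H x) > 0" "F x - q * H x > 0"
    using F_pos[OF assms] by linarith+
qed

text \<open>
  The power series of \<open>F - 2 q H\<close> has the coefficients \<open>c\<^sub>n (1 - 2 q / (n + 1))\<close>, all positive as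
  \<open>q \<le> 1 / 4\<close>.
\<close>

lemma F_minus_qH_mono:
  assumes "0 \<le> x" "x \<le> y" "y < 1"
  shows "F x - 2 * (q * H x) \<le> F y - 2 * (q * H y)"
proof -
  have sums: "(\<lambda>n. (c n - 2 * (q * h n)) * z ^ n) sums (F z - 2 * (q * H z))" if "\<bar>z\<bar> < 1" for z
  proof -
    have "(\<lambda>n. c n * z ^ n - 2 * (q * (h n * z ^ n))) sums (F z - 2 * (q * H z))"
      unfolding F_eq H_def
      by (intro sums_diff sums_mult summable_sums summable_F summable_H that)
    thus ?thesis by (simp add: algebra_simps)
  qed
  show ?thesis
  proof (rule sums_le[OF _ sums sums])
    fix n
    have "q * h n \<le> 1 / 4 * c n"
      using q_le q_pos h_le[of n] h_pos[of n] by (intro mult_mono) auto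
    hence "0 \<le> c n - 2 * (q * h n)" using c_pos[of n] by linarith
    thus "(c n - 2 * (q * h n)) * x ^ n \<le> (c n - 2 * (q * h n)) * y ^ n"
      using assms by (intro mult_left_mono power_mono) auto
  qed (use assms in auto)
qed

lemma XF_strict_mono:
  assumes "0 < x" "x < y" "y < 1"
  shows "x * F (1 - x) < y * F (1 - y)"
proof (rule DERIV_pos_imp_increasing[where f = "\<lambda>t. t * F (1 - t)", OF assms(2)])
  fix t assume "x \<le> t" "t \<le> y"
  with assms have t: "0 < t" "t < 1" by auto
  have d: "((\<lambda>r. F (1 - r)) has_real_derivative q * H (1 - t) / t * (- 1)) (at t)"
    by (rule DERIV_chain2[where f = F and g = "\<lambda>r. 1 - r"], rule DERIV_cong[OF F_deriv])
       (use t in \<open>auto intro!: derivative_eq_intros\<close>)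
  have "((\<lambda>t. t * F (1 - t)) has_real_derivative F (1 - t) - q * H (1 - t)) (at t)"
    by (rule DERIV_cong[OF DERIV_mult[OF DERIV_ident d]]) (use t in auto)
  thus "\<exists>d. ((\<lambda>t. t * F (1 - t)) has_real_derivative d) (at t) \<and> 0 < d"
    using F_minus_qH_pos(2)[of "1 - t"] t by auto
qed

text \<open>
  Up to the factor \<open>\<kappa>\<close> this function of \<open>x = r\<^sup>2\<close> is the elasticity required in \<open>inverse_modulus\<close>, and it is
  a product of increasing positive functions.
\<close>

lemma elasticity_strict_mono:
  assumes "0 < x" "x < y" "y < 1"
  shows "x * F (1 - x) * (F x - 2 * (q * H x)) < y * F (1 - y) * (F y - 2 * (q * H y))"
proof (rule mult_less_le_imp_less)
  show "x * F (1 - x) < y * F (1 - y)" by (rule XF_strict_mono[OF assms])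
  show "F x - 2 * (q * H x) \<le> F y - 2 * (q * H y)" by (rule F_minus_qH_mono) (use assms in auto)
  show "0 \<le> x * F (1 - x)" using F_pos[of "1 - x"] assms by simp
  show "0 < F x - 2 * (q * H x)" using F_minus_qH_pos(1)[of x] assms by simp
qed

section \<open>The distortion function\<close>

text \<open>
  \<open>N\<close>, \<open>g\<close> and \<open>g'\<close> instantiate the parameters of \<open>inverse_modulus\<close>; the formulas for the derivatives
  follow from \<open>\<mu>_inv_deriv\<close> by the chain rule.
\<close>

definition N where "N x = - ln (\<mu>_inv x)"

definition g where "g x = \<gamma> ((\<mu>_inv x)\<^sup>2)"

definition g' where "g' x = - 2 * (\<mu>_inv x)\<^sup>2 * g x * \<gamma>' ((\<mu>_inv x)\<^sup>2)"

lemma elasticity_eq: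
  assumes "x > 0"
  shows "x * g' x / g x = (let X = (\<mu>_inv x)\<^sup>2 in X * F (1 - X) * (F X - 2 * (q * H X)) / \<kappa>)"
proof -
  define X where "X = (\<mu>_inv x)\<^sup>2"
  have X: "0 < X" "X < 1" unfolding X_def using \<mu>_inv_in_unit[OF assms] square_in_unit by auto
  have g: "g x > 0" unfolding g_def using \<gamma>_pos X unfolding X_def by auto
  have "x = F (1 - X) / F X / (2 * \<kappa>)"
    using \<mu>_\<mu>_inv[OF assms] unfolding \<mu>_eq X_def by simp
  moreover have "x * g' x / g x = x * (2 * X * (F X * (F X - 2 * (q * H X))))"
    using g unfolding g'_def \<gamma>'_def X_def[symmetric] by simp
  ultimately have "x * g' x / g x = F (1 - X) / F X / (2 * \<kappa>) * (2 * X * (F X * (F X - 2 * (q * H X))))"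
    by simp
  also have "\<dots> = X * F (1 - X) * (F X - 2 * (q * H X)) / \<kappa>"
    using F_pos[of X] X \<kappa>_pos by (simp add: field_simps)
  finally show ?thesis by (simp add: X_def Let_def)
qed

lemma \<mu>_inv_at_top: "(\<mu>_inv \<longlongrightarrow> 0) at_top"
proof (rule order_tendstoI)
  fix e :: real assume e: "e < 0"
  show "\<forall>\<^sub>F x in at_top. e < \<mu>_inv x"
    using eventually_gt_at_top[of 0]
    by eventually_elim (use e \<mu>_inv_in_unit in force)
next
  fix e :: real assume e: "0 < e"
  define d where "d = min e (1/2)"
  have d: "0 < d" "d < 1" "d \<le> e" using e by (auto simp: d_def)
  show "\<forall>\<^sub>F x in at_top. \<mu>_inv x < e"
    using eventually_gt_at_top[of "\<mu> d"]
  proof eventually_elim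
    case (elim x)
    hence "\<mu>_inv x < d" using d \<mu>_pos[of d] by (subst \<mu>_inv_less_iff) auto
    with d show ?case by simp
  qed
qed

sublocale inverse_modulus N g g'
proof
  fix x :: real assume x: "x > 0"
  note r = \<mu>_inv_in_unit[OF x] and sq = square_in_unit[OF \<mu>_inv_in_unit[OF x]]
  show "(N has_real_derivative g x) (at x)"
    unfolding N_def[abs_def] g_def \<gamma>_def using r
    by (auto intro!: derivative_eq_intros \<mu>_inv_deriv[OF x])
  have "((\<lambda>x. \<gamma> ((\<mu>_inv x)\<^sup>2)) has_real_derivative
      \<gamma>' ((\<mu>_inv x)\<^sup>2) * (2 * \<mu>_inv x * - (\<mu>_inv x * (1 - (\<mu>_inv x)\<^sup>2) * (F ((\<mu>_inv x)\<^sup>2))\<^sup>2))) (at x)"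
    by (rule DERIV_chain2[where f = \<gamma> and g = "\<lambda>x. (\<mu>_inv x)\<^sup>2", OF \<gamma>_deriv])
       (use sq in \<open>auto intro!: derivative_eq_intros \<mu>_inv_deriv[OF x]\<close>)
  also have "\<gamma>' ((\<mu>_inv x)\<^sup>2) * (2 * \<mu>_inv x * - (\<mu>_inv x * (1 - (\<mu>_inv x)\<^sup>2) * (F ((\<mu>_inv x)\<^sup>2))\<^sup>2)) = g' x"
    unfolding g'_def g_def \<gamma>_def by (simp add: power2_eq_square)
  finally show "(g has_real_derivative g' x) (at x)" unfolding g_def[abs_def] .
  show "N x > 0" unfolding N_def using r by simp
  show g: "g x > 0" unfolding g_def using \<gamma>_pos sq by simp
  show "g' x > 0"
    unfolding g'_def \<gamma>'_def using g sq F_minus_qH_pos(1)[of "(\<mu>_inv x)\<^sup>2"] F_pos[of "(\<mu>_inv x)\<^sup>2"] by simp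
next
  show "(N \<longlongrightarrow> 0) (at_right 0)"
  proof (rule order_tendstoI)
    fix e :: real assume e: "e < 0"
    have "\<forall>\<^sub>F x in at_right (0::real). x \<in> {0<..<1}" by (intro eventually_at_right_real) auto
    thus "\<forall>\<^sub>F x in at_right 0. e < N x"
    proof eventually_elim
      case (elim x)
      hence "ln (\<mu>_inv x) < 0" using \<mu>_inv_in_unit[of x] by (intro ln_less_zero) auto
      thus ?case using e unfolding N_def by simp
    qed
  next
    fix e :: real assume e: "0 < e"
    hence "\<forall>\<^sub>F x in at_right (0::real). x \<in> {0<..<\<mu> (exp (- e))}"
      by (intro eventually_at_right_real \<mu>_pos) auto
    thus "\<forall>\<^sub>F x in at_right 0. N x < e"
    proof eventually_elim
      case (elim x)
      hence "exp (- e) < \<mu>_inv x" using e by (subst less_\<mu>_inv_iff) auto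
      hence "ln (exp (- e)) < ln (\<mu>_inv x)" using \<mu>_inv_in_unit[of x] elim by (subst ln_less_cancel_iff) auto
      thus ?case unfolding N_def by simp
    qed
  qed
  have "isCont \<gamma> 0" by (rule DERIV_isCont[OF \<gamma>_deriv]) simp
  moreover have "((\<lambda>x. (\<mu>_inv x)\<^sup>2) \<longlongrightarrow> 0) at_top"
    using tendsto_power[OF \<mu>_inv_at_top, of 2] by simp
  ultimately have "((\<lambda>x. \<gamma> ((\<mu>_inv x)\<^sup>2)) \<longlongrightarrow> \<gamma> 0) at_top"
    by (rule isCont_tendsto_compose)
  thus "(g \<longlongrightarrow> 1) at_top"
    by (simp add: g_def[abs_def] \<gamma>_def F_0)
next
  fix x y :: real assume xy: "0 < x" "x < y"
  have "(\<mu>_inv y)\<^sup>2 < (\<mu>_inv x)\<^sup>2"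
    using \<mu>_inv_strict_antimono[OF xy] \<mu>_inv_in_unit[of y] xy by (intro power_strict_mono) auto
  thus "y * g' y / g y < x * g' x / g x"
    unfolding elasticity_eq[OF xy(1)] elasticity_eq[OF less_trans[OF xy]] Let_def
    using xy \<kappa>_pos square_in_unit \<mu>_inv_in_unit[of x] \<mu>_inv_in_unit[of y]
    by (intro divide_strict_right_mono elasticity_strict_mono) auto
qed

lemma N_\<mu>: "0 < r \<Longrightarrow> r < 1 \<Longrightarrow> N (\<mu> r) = - ln r"
  by (simp add: N_def \<mu>_inv_\<mu>)

text \<open>
  The Huebner function is \<open>- \<mu> r / (r \<mu>' r)\<close>. This is why it enters the slope of the log ratio at \<open>K = 1\<close>.
\<close>

lemma gen_hubner_eq:
  assumes r: "0 < r" "r < 1"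
  shows "gen_hubner a r = \<mu> r * g (\<mu> r)"
proof -
  define X where "X = r\<^sup>2"
  have X: "0 < X" "X < 1" unfolding X_def using square_in_unit[OF r] by auto
  have "sin (pi * a) \<noteq> 0" using \<kappa>_pos by (auto simp: \<kappa>_def)
  hence "gen_hubner a r = (1 - X) * F X * F (1 - X) / (2 * \<kappa>)"
    using X unfolding gen_hubner_def gen_elliptic_K_def X_def[symmetric] \<kappa>_def
    by (simp add: field_simps)
  moreover have "\<mu> r * g (\<mu> r) = F (1 - X) / F X / (2 * \<kappa>) * ((1 - X) * (F X)\<^sup>2)"
    unfolding g_def \<mu>_inv_\<mu>[OF r] \<gamma>_def X_def[symmetric] by (simp add: \<mu>_eq X_def)
  ultimately show ?thesis using F_pos[of X] X by (simp add: power2_eq_square)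
qed

lemma powr_in_unit: "0 < r \<Longrightarrow> r < 1 \<Longrightarrow> p > 0 \<Longrightarrow> 0 < r powr p \<and> r powr p < 1" for r p :: real
  using powr01_less_one[of r p] by simp

text \<open>
  The factor \<open>p\<close> is recovered as \<open>N (\<mu> (r powr p)) / N (\<mu> r)\<close>, since \<open>N (\<mu> r) = - ln r\<close>.
\<close>

lemma distortion_ratio:
  assumes r: "0 < r" "r < 1" and p: "p > 0" and K: "K > 0"
  shows "gen_hersch_pfluger a K r powr p / gen_hersch_pfluger a K (r powr p)
      = exp (log_ratio (\<mu> r) (\<mu> (r powr p)) (1 / K))"
proof -
  define x y where "x = \<mu> r" and "y = \<mu> (r powr p)"
  have xy: "x > 0" "y > 0" using \<mu>_pos r powr_in_unit[OF r p] by (auto simp: x_def y_def)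
  have "N y / N x = p"
    unfolding x_def y_def using r powr_in_unit[OF r p] by (simp add: N_\<mu> ln_powr)
  moreover have "\<mu>_inv (x / K) > 0" "\<mu>_inv (y / K) > 0" using xy K \<mu>_inv_in_unit by auto
  ultimately have "exp (log_ratio x y (1 / K)) = \<mu>_inv (x / K) powr p / \<mu>_inv (y / K)"
    unfolding log_ratio_def N_def by (simp add: exp_diff exp_minus powr_def field_simps)
  thus ?thesis unfolding gen_hersch_pfluger_def x_def y_def \<mu>_inv_def by simp
qed

lemma bounds_p_less_1:
  assumes r: "0 < r" "r < 1" and p: "0 < p" "p < 1"
  shows "(\<forall>K>1. gen_hersch_pfluger a K r powr p / gen_hersch_pfluger a K (r powr p) > exp (\<delta> * (1 - 1 / K)))
      \<longleftrightarrow> \<delta> \<le> p * gen_hubner a r - gen_hubner a (r powr p)" (is ?A)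
    and "(\<forall>K>1. exp (\<zeta> * (1 - K)) < gen_hersch_pfluger a (1 / K) r powr p / gen_hersch_pfluger a (1 / K) (r powr p))
      \<longleftrightarrow> \<zeta> \<ge> p * gen_hubner a r - gen_hubner a (r powr p)" (is ?B)
    and "(\<forall>K>1. gen_hersch_pfluger a (1 / K) r powr p / gen_hersch_pfluger a (1 / K) (r powr p) < exp (\<eta> * (1 - K)))
      \<longleftrightarrow> \<eta> \<le> p * gen_grotzsch a r - gen_grotzsch a (r powr p)" (is ?C)
proof -
  define x y where "x = \<mu> r" and "y = \<mu> (r powr p)"
  note rp = powr_in_unit[OF r p(1)]
  have "r < r powr p" using powr_less_mono'[of r p 1] r p by simp
  hence yx: "0 < y" "y < x" "0 < x"
    unfolding x_def y_def using r rp \<mu>_pos \<mu>_strict_antimono by auto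
  have N: "N y / N x = p"
    unfolding x_def y_def using r rp by (simp add: N_\<mu> ln_powr)
  have m: "gen_hubner a r = x * g x" "gen_hubner a (r powr p) = y * g y"
    unfolding x_def y_def using gen_hubner_eq r rp by auto
  have ratio: "gen_hersch_pfluger a K r powr p / gen_hersch_pfluger a K (r powr p)
      = exp (log_ratio x y (1 / K))" if "K > 0" for K
    unfolding x_def y_def by (rule distortion_ratio[OF r p(1) that])
  note tangent = sharp_tangent_left_iff[OF log_ratio_1 log_ratio_deriv_1 log_ratio_above_tangent, OF yx(3) yx(3,1) _ _ yx(1,2)]
    sharp_tangent_right_iff[OF log_ratio_1 log_ratio_deriv_1 log_ratio_above_tangent, OF yx(3) yx(3,1) _ _ yx(1,2)]
  note asymptote = sharp_asymptote_iff[OF log_ratio_asymptotic_slope log_ratio_below_asymptote, OF yx(3,1) _ yx(1,2)]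
  show ?A using tangent(1)[of \<delta>] by (simp add: ratio m N)
  show ?B using tangent(2)[of \<zeta>] by (simp add: ratio m N)
  show ?C using asymptote[of \<eta>] by (simp add: ratio N flip: x_def y_def)
qed

text \<open>
  Reduction to the exponent \<open>1 / p < 1\<close>: with \<open>s = r powr p\<close> one has \<open>r = s powr (1 / p)\<close>, and the ratio for
  \<open>(r, p)\<close> is the ratio for \<open>(s, 1 / p)\<close> raised to the power \<open>- p\<close>. The negative power reverses all
  inequalities.
\<close>

lemma bounds_p_greater_1:
  assumes r: "0 < r" "r < 1" and p: "p > 1"
  shows "(\<forall>K>1. gen_hersch_pfluger a K r powr p / gen_hersch_pfluger a K (r powr p) < exp (\<delta> * (1 - 1 / K)))
      \<longleftrightarrow> \<delta> \<ge> p * gen_hubner a r - gen_hubner a (r powr p)" (is ?A)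
    and "(\<forall>K>1. exp (\<zeta> * (1 - K)) < gen_hersch_pfluger a (1 / K) r powr p / gen_hersch_pfluger a (1 / K) (r powr p))
      \<longleftrightarrow> \<zeta> \<ge> p * gen_grotzsch a r - gen_grotzsch a (r powr p)" (is ?B)
    and "(\<forall>K>1. gen_hersch_pfluger a (1 / K) r powr p / gen_hersch_pfluger a (1 / K) (r powr p) < exp (\<eta> * (1 - K)))
      \<longleftrightarrow> \<eta> \<le> p * gen_hubner a r - gen_hubner a (r powr p)" (is ?C)
proof -
  define s where "s = r powr p"
  have s: "0 < s" "s < 1" unfolding s_def using powr_in_unit[OF r, of p] p by auto
  have r_eq: "r = s powr (1 / p)" unfolding s_def using r p by (simp add: powr_powr)
  define \<rho> where "\<rho> = (\<lambda>K. gen_hersch_pfluger a K s powr (1 / p) / gen_hersch_pfluger a K r)"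
  have pos: "gen_hersch_pfluger a K r > 0" "gen_hersch_pfluger a K s > 0" if "K > 0" for K
    using \<mu>_inv_in_unit[of "\<mu> _ / K"] \<mu>_pos r s that by (auto simp: gen_hersch_pfluger_def \<mu>_inv_def)
  have \<rho>: "\<rho> K > 0" "gen_hersch_pfluger a K r powr p / gen_hersch_pfluger a K s = \<rho> K powr (- p)"
    if "K > 0" for K
    using pos[OF that] p unfolding \<rho>_def
    by (simp_all add: powr_divide powr_powr powr_minus field_simps)
  have powr_iff: "x powr (- p) < exp t \<longleftrightarrow> exp (- t / p) < x" "exp t < x powr (- p) \<longleftrightarrow> x < exp (- t / p)"
    if "x > 0" for x t :: real
  proof -
    have "x powr (- p) = exp (- p * ln x)" using that by (simp add: powr_def)
    moreover have "- p * ln x < t \<longleftrightarrow> - t / p < ln x" "t < - p * ln x \<longleftrightarrow> ln x < - t / p"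
      using p by (auto simp: field_simps)
    ultimately show "x powr (- p) < exp t \<longleftrightarrow> exp (- t / p) < x" "exp t < x powr (- p) \<longleftrightarrow> x < exp (- t / p)"
      using that exp_ln[OF that] by (metis exp_less_cancel_iff)+
  qed
  have p': "0 < 1 / p" "1 / p < 1" using p by auto
  note dual = bounds_p_less_1[OF s p', folded r_eq, folded \<rho>_def]
  have "(\<forall>K>1. gen_hersch_pfluger a K r powr p / gen_hersch_pfluger a K s < exp (\<delta> * (1 - 1 / K)))
      \<longleftrightarrow> (\<forall>K>1. exp (- \<delta> / p * (1 - 1 / K)) < \<rho> K)"
    using \<rho> by (simp add: powr_iff)
  also have "\<dots> \<longleftrightarrow> - \<delta> / p \<le> 1 / p * gen_hubner a s - gen_hubner a r"
    by (simp only: dual \<rho>_def)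
  also have "\<dots> \<longleftrightarrow> \<delta> \<ge> p * gen_hubner a r - gen_hubner a s"
    using p by (simp add: field_simps)
  finally show ?A unfolding s_def .
  have "(\<forall>K>1. exp (\<zeta> * (1 - K)) < gen_hersch_pfluger a (1 / K) r powr p / gen_hersch_pfluger a (1 / K) s)
      \<longleftrightarrow> (\<forall>K>1. \<rho> (1 / K) < exp (- \<zeta> / p * (1 - K)))"
    using \<rho> by (simp add: powr_iff)
  also have "\<dots> \<longleftrightarrow> - \<zeta> / p \<le> 1 / p * gen_grotzsch a s - gen_grotzsch a r"
    by (simp only: dual \<rho>_def)
  also have "\<dots> \<longleftrightarrow> \<zeta> \<ge> p * gen_grotzsch a r - gen_grotzsch a s"
    using p by (simp add: field_simps)
  finally show ?B unfolding s_def .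
  have "(\<forall>K>1. gen_hersch_pfluger a (1 / K) r powr p / gen_hersch_pfluger a (1 / K) s < exp (\<eta> * (1 - K)))
      \<longleftrightarrow> (\<forall>K>1. exp (- \<eta> / p * (1 - K)) < \<rho> (1 / K))"
    using \<rho> by (simp add: powr_iff)
  also have "\<dots> \<longleftrightarrow> - \<eta> / p \<ge> 1 / p * gen_hubner a s - gen_hubner a r"
    by (simp only: dual \<rho>_def)
  also have "\<dots> \<longleftrightarrow> p * (1 / p * gen_hubner a s - gen_hubner a r) \<le> p * (- \<eta> / p)"
    using p by (subst mult_le_cancel_left_pos) auto
  also have "\<dots> \<longleftrightarrow> \<eta> \<le> p * gen_hubner a r - gen_hubner a s"
    using p by (auto simp: right_diff_distrib)
  finally show ?C unfolding s_def .
qed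

end

section \<open>Sharp bounds for all parameters\<close>

theorem theorem3p2:
  fixes \<delta> \<zeta> \<eta> :: "real \<Rightarrow> real \<Rightarrow> real" and p :: real
  shows
    "(0 < p \<and> p < 1 \<longrightarrow>
        ((\<forall>a\<in>{0<..1/2}. \<forall>r\<in>{0<..<1}. \<forall>K>1.
            gen_hersch_pfluger a K r powr p / gen_hersch_pfluger a K (r powr p)
              > exp (\<delta> a r * (1 - 1 / K)))
         \<longleftrightarrow> (\<forall>a\<in>{0<..1/2}. \<forall>r\<in>{0<..<1}.
            \<delta> a r \<le> p * gen_hubner a r - gen_hubner a (r powr p)))
      \<and> ((\<forall>a\<in>{0<..1/2}. \<forall>r\<in>{0<..<1}. \<forall>K>1.
            exp (\<zeta> a r * (1 - K))
              < gen_hersch_pfluger a (1 / K) r powr p / gen_hersch_pfluger a (1 / K) (r powr p))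
         \<longleftrightarrow> (\<forall>a\<in>{0<..1/2}. \<forall>r\<in>{0<..<1}.
            \<zeta> a r \<ge> p * gen_hubner a r - gen_hubner a (r powr p)))
      \<and> ((\<forall>a\<in>{0<..1/2}. \<forall>r\<in>{0<..<1}. \<forall>K>1.
            gen_hersch_pfluger a (1 / K) r powr p / gen_hersch_pfluger a (1 / K) (r powr p)
              < exp (\<eta> a r * (1 - K)))
         \<longleftrightarrow> (\<forall>a\<in>{0<..1/2}. \<forall>r\<in>{0<..<1}.
            \<eta> a r \<le> p * gen_grotzsch a r - gen_grotzsch a (r powr p))))
   \<and> (p > 1 \<longrightarrow>
        ((\<forall>a\<in>{0<..1/2}. \<forall>r\<in>{0<..<1}. \<forall>K>1.
            gen_hersch_pfluger a K r powr p / gen_hersch_pfluger a K (r powr p)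
              < exp (\<delta> a r * (1 - 1 / K)))
         \<longleftrightarrow> (\<forall>a\<in>{0<..1/2}. \<forall>r\<in>{0<..<1}.
            \<delta> a r \<ge> p * gen_hubner a r - gen_hubner a (r powr p)))
      \<and> ((\<forall>a\<in>{0<..1/2}. \<forall>r\<in>{0<..<1}. \<forall>K>1.
            exp (\<zeta> a r * (1 - K))
              < gen_hersch_pfluger a (1 / K) r powr p / gen_hersch_pfluger a (1 / K) (r powr p))
         \<longleftrightarrow> (\<forall>a\<in>{0<..1/2}. \<forall>r\<in>{0<..<1}.
            \<zeta> a r \<ge> p * gen_grotzsch a r - gen_grotzsch a (r powr p)))
      \<and> ((\<forall>a\<in>{0<..1/2}. \<forall>r\<in>{0<..<1}. \<forall>K>1.
            gen_hersch_pfluger a (1 / K) r powr p / gen_hersch_pfluger a (1 / K) (r powr p)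
              < exp (\<eta> a r * (1 - K)))
         \<longleftrightarrow> (\<forall>a\<in>{0<..1/2}. \<forall>r\<in>{0<..<1}.
            \<eta> a r \<le> p * gen_hubner a r - gen_hubner a (r powr p))))"
proof -
  have loc: "hypergeometric_parameter a" if "a \<in> {0<..1/2}" for a
    using that by unfold_locales auto
  note less = hypergeometric_parameter.bounds_p_less_1[OF loc]
  note greater = hypergeometric_parameter.bounds_p_greater_1[OF loc]
  show ?thesis
    by (intro conjI impI ball_cong refl; (rule less greater; simp))
qed

end
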